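(* For every $\alpha\in[0,\infty)$, the set $\{x\in(0,1):\lambda(x)\le\alpha\}$ is of the first Baire category in $(0,1)$; and the set $\{x\in(0,1):\lambda(x)=\infty\}$ is residual in $(0,1)$. Here $\lambda(x)$ denotes the exponent of convergence of the sequence of Engel digits of $x$.
   Context: Engel series: let $T:[0,1)\to[0,1)$ be defined by $T(0)=0$ and $T(x)=x\lceil 1/x\rceil-1$ for $x\in(0,1)$, where $\lceil y\rceil$ is the least integer not less than $y$. For $x\in(0,1)$ put $d_1(x)=\lceil 1/x\rceil$ and $d_{n+1}(x)=d_1(T^n(x))$ for $n\ge1$, as long as $T^n(x)\neq0$; these positive integers are the digits of the Engel expansion $x=\frac1{d_1(x)}+\frac1{d_1(x)d_2(x)}+\cdots$. If $T^k(x)=0$ for some $k$, the digit sequence is finite (this happens exactly when $x$ is rational); otherwise it is infinite. Exponent of convergence: for $x\in(0,1)$, $\lambda(x)=\inf\{s\ge0:\sum_{n\ge1}d_n(x)^{-s}<\infty\}\in[0,\infty]$, the sum being over all digits of $x$ and $\inf\emptyset=\infty$. In particular $\lambda(x)=0$ if $x$ is rational. A set is of the first Baire category in $(0,1)$ if it is a countable union of nowhere dense sets; a set is residual in $(0,1)$ if its complement in $(0,1)$ is of the first Baire category. *)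

theory Defs
  imports "HOL-Analysis.Analysis"
begin

section \<open>Engel expansions\<close>

text \<open>The map is meant on \<open>[0,1)\<close>; its values at other reals are irrelevant, since \<open>[0,1)\<close> is
  mapped into itself.\<close>

definition engel_map :: "real \<Rightarrow> real" where
  "engel_map x = (if x = 0 then 0 else x * of_int \<lceil>1 / x\<rceil> - 1)"

definition engel_first_digit :: "real \<Rightarrow> int" where
  "engel_first_digit x = \<lceil>1 / x\<rceil>"

text \<open>The digits are numbered from 1, and the digit number \<open>n\<close> exists only if \<open>n\<close> belongs to
  \<open>engel_indices x\<close>; outside that set \<open>engel_digit x n\<close> is a dummy value.\<close>

definition engel_indices :: "real \<Rightarrow> nat set" where
  "engel_indices x = {n. 1 \<le> n \<and> (engel_map ^^ (n - 1)) x \<noteq> 0}"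

definition engel_digit :: "real \<Rightarrow> nat \<Rightarrow> int" where
  "engel_digit x n = engel_first_digit ((engel_map ^^ (n - 1)) x)"

text \<open>In \<^typ>\<open>ereal\<close> the infimum of the empty set is \<open>\<infinity>\<close>, as required here.\<close>

definition engel_exponent :: "real \<Rightarrow> ereal" where
  "engel_exponent x =
     Inf {ereal s | s :: real.
            0 \<le> s \<and> (\<lambda>n. real_of_int (engel_digit x n) powr (- s)) summable_on engel_indices x}"

section \<open>Baire category\<close>

definition nowhere_dense_in :: "'a topology \<Rightarrow> 'a set \<Rightarrow> bool" where
  "nowhere_dense_in X A \<longleftrightarrow> A \<subseteq> topspace X \<and> X interior_of (X closure_of A) = {}"

definition first_category_in :: "'a topology \<Rightarrow> 'a set \<Rightarrow> bool" where
  "first_category_in X A \<longleftrightarrow>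
     (\<exists>\<F>. countable \<F> \<and> (\<forall>N\<in>\<F>. nowhere_dense_in X N) \<and> A = \<Union>\<F>)"

definition residual_in :: "'a topology \<Rightarrow> 'a set \<Rightarrow> bool" where
  "residual_in X A \<longleftrightarrow> A \<subseteq> topspace X \<and> first_category_in X (topspace X - A)"

end

theory Submission
  imports Defs
begin

text \<open>If \<open>\<lambda>(x) \<le> \<alpha>\<close> then the series \<open>\<Sum> d\<^sub>n(x) powr -(\<alpha> + 1)\<close> converges, so its finite partial sums
  are bounded by some natural number \<open>M\<close>. For fixed \<open>M\<close> such points form a nowhere dense set: near
  a rational \<open>r\<close> some iterate \<open>T\<^sup>n\<close> is affine and increasing with \<open>T\<^sup>n r = 1/m\<close>, and since \<open>1/m\<close> is a
  repelling fixed point of the branch of \<open>T\<close> immediately to its left, all points just to the left of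
  \<open>r\<close> have the digit \<open>m + 1\<close> repeated as many times as desired.\<close>

section \<open>Nowhere dense and first category sets\<close>

lemma nowhere_dense_inI:
  assumes "A \<subseteq> topspace X"
    and "\<And>U. openin X U \<Longrightarrow> U \<noteq> {} \<Longrightarrow> \<exists>W. openin X W \<and> W \<noteq> {} \<and> W \<subseteq> U \<and> W \<inter> A = {}"
  shows "nowhere_dense_in X A"
  unfolding nowhere_dense_in_def
proof (intro conjI assms(1), rule ccontr)
  let ?U = "X interior_of (X closure_of A)"
  assume "?U \<noteq> {}"
  then obtain W where W: "openin X W" "W \<noteq> {}" "W \<subseteq> ?U" "W \<inter> A = {}"
    using assms(2)[of ?U] by auto
  have "W \<inter> X closure_of A = {}"
    using W openin_Int_closure_of_eq_empty by blast
  then show False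
    using W interior_of_subset[of X "X closure_of A"] by blast
qed

lemma nowhere_dense_in_subset:
  assumes "nowhere_dense_in X A" "B \<subseteq> A"
  shows "nowhere_dense_in X B"
  using assms closure_of_mono[of B A X] interior_of_mono[of "X closure_of B" "X closure_of A" X]
  unfolding nowhere_dense_in_def by blast

lemma first_category_in_UN:
  fixes A :: "nat \<Rightarrow> 'a set"
  assumes "\<And>k. first_category_in X (A k)"
  shows "first_category_in X (\<Union>k. A k)"
proof -
  obtain F where F: "\<And>k. countable (F k) \<and> (\<forall>N\<in>F k. nowhere_dense_in X N) \<and> A k = \<Union>(F k)"
    using assms unfolding first_category_in_def by metis
  show ?thesis
    unfolding first_category_in_def
    by (rule exI[of _ "\<Union>k. F k"]) (use F in auto)
qed

text \<open>Since \<open>first_category_in\<close> asks for an exact union, each member of the cover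
  is first cut down to its trace on \<open>A\<close>.\<close>

lemma first_category_in_nowhere_dense_cover:
  fixes F :: "nat \<Rightarrow> 'a set"
  assumes "\<And>k. nowhere_dense_in X (F k)" "A \<subseteq> (\<Union>k. F k)"
  shows "first_category_in X A"
  unfolding first_category_in_def
proof (intro exI conjI)
  show "countable (range (\<lambda>k. A \<inter> F k))" by simp
  show "\<forall>N\<in>range (\<lambda>k. A \<inter> F k). nowhere_dense_in X N"
    using nowhere_dense_in_subset[OF assms(1)] by blast
  show "A = \<Union>(range (\<lambda>k. A \<inter> F k))" using assms(2) by auto
qed

section \<open>The Engel map, its branches and its iterates\<close>

lemma engel_map_bounds:
  assumes "0 \<le> x" "x < 1"
  shows "0 \<le> engel_map x" "engel_map x < 1"
proof -
  have "0 \<le> engel_map x \<and> engel_map x < 1"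
  proof (cases "x = 0")
    case False
    then have x: "x > 0" using assms by simp
    have "1 / x \<le> of_int \<lceil>1 / x\<rceil>" "of_int \<lceil>1 / x\<rceil> < 1 / x + 1"
      by linarith+
    then have "x * (1 / x) \<le> x * of_int \<lceil>1 / x\<rceil>" "x * of_int \<lceil>1 / x\<rceil> < x * (1 / x + 1)"
      using x by (intro mult_left_mono mult_strict_left_mono; simp)+
    then show ?thesis
      using x assms by (auto simp: engel_map_def distrib_left)
  qed (simp add: engel_map_def)
  then show "0 \<le> engel_map x" "engel_map x < 1" by auto
qed

lemma engel_iterate_bounds:
  assumes "0 \<le> x" "x < 1"
  shows "0 \<le> (engel_map ^^ n) x \<and> (engel_map ^^ n) x < 1"
  by (induction n) (use assms engel_map_bounds in auto)

text \<open>A base of at least 1 makes \<open>powr\<close> monotone in the exponent, which allows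
  series with different exponents to be compared.\<close>

lemma engel_digit_ge_1:
  assumes "0 \<le> x" "x < 1" "n \<in> engel_indices x"
  shows "1 \<le> engel_digit x n"
proof -
  have "0 < 1 / (engel_map ^^ (n - 1)) x"
    using engel_iterate_bounds[OF assms(1,2), of "n - 1"] assms(3)
    by (auto simp: engel_indices_def)
  then show ?thesis
    unfolding engel_digit_def engel_first_digit_def by linarith
qed

text \<open>The hypotheses describe the interval [1/d, 1/(d-1)); writing its right end as a product
  avoids a division by zero at d = 1.\<close>

lemma engel_first_digit_eq:
  assumes "0 < d" "1 / of_int d \<le> x" "of_int (d - 1) * x < 1"
  shows "engel_first_digit x = d"
proof -
  have "0 < 1 / real_of_int d" using assms(1) by simp
  then have x: "x > 0" using assms(2) by linarith
  have "1 / x \<le> of_int d" "of_int (d - 1) < 1 / x"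
    using assms x by (auto simp: field_simps)
  then show ?thesis
    unfolding engel_first_digit_def by (simp add: ceiling_eq_iff)
qed

lemma engel_map_branch:
  assumes "0 < d" "1 / of_int d \<le> x" "of_int (d - 1) * x < 1"
  shows "engel_map x = of_int d * x - 1"
proof -
  have "0 < 1 / real_of_int d" using assms(1) by simp
  then have "x \<noteq> 0" using assms(2) by linarith
  then show ?thesis
    using engel_first_digit_eq[OF assms] by (simp add: engel_map_def engel_first_digit_def)
qed

text \<open>The induction is on the numerator, which the Engel map decreases as long as it does not divide
  the denominator.\<close>

lemma engel_iterate_affine_at_rational:
  fixes p q :: nat
  assumes "0 < p" "p < q"
  shows "\<exists>n m D e. 2 \<le> m \<and> 0 < D \<and> 0 < e \<and>
    (\<forall>y. \<bar>y - p / q\<bar> < e \<longrightarrow> (engel_map ^^ n) y = 1 / real m + D * (y - p / q))"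
  using assms
proof (induction p rule: less_induct)
  case (less p)
  show ?case
  proof (cases "p dvd q")
    case True
    then obtain m where m: "q = p * m" by blast
    have "2 \<le> m" using less.prems m by (cases m; cases "m - 1") auto
    moreover have "real p / q = 1 / m" using m less.prems by simp
    ultimately show ?thesis
      by (intro exI[of _ 0] exI[of _ m] exI[of _ 1]) simp_all
  next
    case False
    \<comment> \<open>The first digit of p/q is c + 1, as p does not divide q. The image is ((c + 1)
      p - q)/q = p'/q, with the same denominator and 0 < p' < p.\<close>
    define c where "c = q div p"
    define x where "x = real p / q"
    define p' where "p' = p - q mod p"
    have mod: "0 < q mod p" "q mod p < p"
      using False less.prems by (auto simp: dvd_eq_mod_eq_0)
    have q: "q = c * p + q mod p" by (simp add: c_def)
    have p': "0 < p'" "p' < p" "p' < q" using mod less.prems by (auto simp: p'_def)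
    have "real q = real (c * p + q mod p)" using q by simp
    moreover have "real p' = real p - real (q mod p)"
      using mod by (simp add: p'_def)
    ultimately have qR: "real q = (c + 1) * real p - p'" by (simp add: algebra_simps)
    obtain n m D e where IH: "2 \<le> m" "0 < D" "0 < e"
      "\<And>y. \<bar>y - p' / q\<bar> < e \<Longrightarrow> (engel_map ^^ n) y = 1 / real m + D * (y - p' / q)"
      using less.IH[of p'] p' by blast
    have q0: "real q > 0" using less.prems by simp
    have x: "(c + 1) * x - 1 = p' / q"
      using q0 qR by (simp add: x_def field_simps)
    have x1: "1 / (c + 1) < x"
    proof -
      have "0 < p' / q" using p' q0 by simp
      then have "1 < (c + 1) * x" using x by linarith
      then show ?thesis by (simp add: field_simps)
    qed
    have x2: "c * x < 1"
    proof -
      have "real (c * p) < q" using q mod by linarith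
      then show ?thesis using q0 by (simp add: x_def field_simps)
    qed
    \<comment> \<open>Because x lies strictly inside its branch interval, all points near x have the
      same first digit.\<close>
    have "open {y. 1 / (c + 1) < y \<and> real c * y < 1}"
      by (intro open_Collect_conj open_Collect_less continuous_intros)
    then obtain e1 where e1: "0 < e1"
      "\<And>y. \<bar>y - x\<bar> < e1 \<Longrightarrow> 1 / (c + 1) < y \<and> real c * y < 1"
      using x1 x2 by (auto simp: open_real)
    have "(engel_map ^^ Suc n) y = 1 / real m + D * (c + 1) * (y - x)"
      \<comment> \<open>The branch stretches distances by c + 1, so the factor 1/(c + 1) keeps the
        image within the radius \<open>e\<close> of the induction hypothesis.\<close>
      if y: "\<bar>y - x\<bar> < min e1 (e / (c + 1))" for y
    proof -
      have "engel_map y = (c + 1) * y - 1"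
        using engel_map_branch[of "int c + 1" y] e1(2)[of y] y by (auto simp: add.commute)
      then have T: "engel_map y - p' / q = (c + 1) * (y - x)"
        using x by (simp add: algebra_simps)
      have "(c + 1) * \<bar>y - x\<bar> < e"
        using y by (simp add: pos_less_divide_eq mult.commute)
      then have "\<bar>engel_map y - p' / q\<bar> < e"
        unfolding T by (simp add: abs_mult)
      from IH(4)[OF this] show ?thesis
        by (simp add: T funpow_Suc_right del: funpow.simps)
    qed
    moreover have "0 < D * (c + 1)" "0 < min e1 (e / (c + 1))" using IH e1(1) by auto
    ultimately show ?thesis
      using IH(1) unfolding x_def[symmetric] by blast
  qed
qed

text \<open>The affine map y -> (m + 1) y - 1 fixes 1/m and multiplies the distance to it by m + 1.
  The bound at the largest power \<open>N\<close> keeps every earlier iterate in [1/(m + 1), 1/m)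
  too.\<close>

lemma engel_iterate_left_of_reciprocal:
  fixes m :: nat and h :: real
  assumes "2 \<le> m" "0 < h" "(m + 1) ^ N * h \<le> 1 / m - 1 / (m + 1)" "k \<le> N"
  shows "(engel_map ^^ k) (1 / m - h) = 1 / m - (m + 1) ^ k * h"
    and "(engel_map ^^ k) (1 / m - h) \<noteq> 0"
    and "engel_first_digit ((engel_map ^^ k) (1 / m - h)) = int m + 1"
proof -
  have range: "1 / real_of_int (int m + 1) \<le> 1 / m - (m + 1) ^ j * h"
    "real_of_int (int m + 1 - 1) * (1 / m - (m + 1) ^ j * h) < 1" if "j \<le> N" for j
  proof -
    have "real ((m + 1) ^ j) \<le> (m + 1) ^ N"
      using that by (intro of_nat_mono power_increasing) auto
    then have "(m + 1) ^ j * h \<le> (m + 1) ^ N * h"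
      using assms(2) by (intro mult_right_mono) auto
    then show "1 / real_of_int (int m + 1) \<le> 1 / m - (m + 1) ^ j * h"
      using assms(3) by (simp add: add.commute)
    have "0 < (m + 1) ^ j * h" using assms(2) by simp
    then show "real_of_int (int m + 1 - 1) * (1 / m - (m + 1) ^ j * h) < 1"
      using assms(1) by (simp add: right_diff_distrib)
  qed
  have it: "(engel_map ^^ j) (1 / m - h) = 1 / m - (m + 1) ^ j * h" if "j \<le> N" for j
    using that
  proof (induction j)
    case (Suc j)
    then have "(engel_map ^^ Suc j) (1 / m - h) = engel_map (1 / m - (m + 1) ^ j * h)"
      by simp
    also have "\<dots> = of_int (int m + 1) * (1 / m - (m + 1) ^ j * h) - 1"
      by (rule engel_map_branch) (use range[of j] Suc.prems in auto)
    also have "\<dots> = 1 / m - (m + 1) ^ Suc j * h"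
      using assms(1) by (simp add: field_simps)
    finally show ?case .
  qed simp
  show eq: "(engel_map ^^ k) (1 / m - h) = 1 / m - (m + 1) ^ k * h"
    using it assms(4) by simp
  have "0 < 1 / real_of_int (int m + 1)" by simp
  then show "(engel_map ^^ k) (1 / m - h) \<noteq> 0"
    using range(1)[OF assms(4)] unfolding eq by linarith
  show "engel_first_digit ((engel_map ^^ k) (1 / m - h)) = int m + 1"
    unfolding eq by (rule engel_first_digit_eq) (use range[OF assms(4)] in auto)
qed

section \<open>Nowhere density of the sets with bounded digit sums\<close>

text \<open>Bounding all finite subsums means that finitely many digits suffice to refute
  membership.\<close>

definition engel_bounded :: "real \<Rightarrow> nat \<Rightarrow> real set" where
  "engel_bounded s M = {x \<in> {0<..<1}. \<forall>A. finite A \<longrightarrow> A \<subseteq> engel_indices x \<longrightarrow>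
     (\<Sum>n\<in>A. real_of_int (engel_digit x n) powr (- s)) \<le> M}"

lemma nowhere_dense_engel_bounded:
  "nowhere_dense_in (top_of_set {0<..<1}) (engel_bounded s M)"
proof (rule nowhere_dense_inI)
  show "engel_bounded s M \<subseteq> topspace (top_of_set {0<..<1})"
    unfolding engel_bounded_def topspace_euclidean_subtopology by blast
  fix U :: "real set"
  assume "openin (top_of_set {0<..<1}) U" and ne: "U \<noteq> {}"
  then have U: "open U" "U \<subseteq> {0<..<1}"
    by (auto simp: openin_open_eq)
  obtain r where r: "r \<in> \<rat>" "r \<in> U"
  proof -
    obtain u where u: "u \<in> U" using ne by blast
    then obtain e where e: "0 < e" "\<And>y. \<bar>y - u\<bar> < e \<Longrightarrow> y \<in> U"
      using U(1) by (auto simp: open_real)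
    obtain r where "r \<in> \<rat>" "u < r" "r < u + e"
      using Rats_dense_in_real[of u "u + e"] e(1) by auto
    then show ?thesis using that e(2)[of r] by auto
  qed
  then have r01: "0 < r" "r < 1" using U by auto
  obtain p q :: nat where pq: "q \<noteq> 0" "r = p / q"
    using Rats_abs_nat_div_natE[OF r(1)] abs_of_pos[OF r01(1)] by metis
  have "0 < p" "p < q" using pq r01 by (auto intro: gr0I)
  from engel_iterate_affine_at_rational[OF this] obtain n m D e where
    nm: "2 \<le> m" "0 < D" "0 < e"
    "\<And>y. \<bar>y - r\<bar> < e \<Longrightarrow> (engel_map ^^ n) y = 1 / real m + D * (y - r)"
    unfolding pq(2) by blast
  obtain e2 where e2: "0 < e2" "\<And>y. \<bar>y - r\<bar> < e2 \<Longrightarrow> y \<in> U"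
    using U(1) r(2) by (auto simp: open_real)
  \<comment> \<open>Each digit m + 1 contributes \<open>w\<close> to the sum, so \<open>N\<close>
    copies of it exceed \<open>M\<close>.\<close>
  define w where "w = real (m + 1) powr (- s)"
  have w: "w > 0" by (simp add: w_def)
  obtain N :: nat where N: "real M < N * w"
    using reals_Archimedean3[OF w] by blast
  define \<delta> where "\<delta> = (1 / m - 1 / (m + 1)) / (m + 1) ^ N"
  have \<delta>: "\<delta> > 0" using nm(1) by (auto simp: \<delta>_def frac_less2 intro!: divide_pos_pos)
  \<comment> \<open>The three bounds secure the affine formula for the iterate, membership in
    \<open>U\<close>, and a distance below \<delta> from 1/m after \<open>n\<close> steps.\<close>
  define \<epsilon> where "\<epsilon> = min e (min e2 (\<delta> / D))"
  have \<epsilon>: "\<epsilon> > 0" using nm e2 \<delta> by (simp add: \<epsilon>_def)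
  have WU: "{r - \<epsilon><..<r} \<subseteq> U"
    using e2(2) by (auto simp: \<epsilon>_def)
  have "y \<notin> engel_bounded s M" if y: "y \<in> {r - \<epsilon><..<r}" for y
  proof
    assume yb: "y \<in> engel_bounded s M"
    \<comment> \<open>As D > 0, points left of \<open>r\<close> are carried to the left of 1/m;
      \<open>h\<close> is their distance from it.\<close>
    define h where "h = D * (r - y)"
    have h: "0 < h" using y nm by (simp add: h_def)
    have "r - y < \<delta> / D" using y by (auto simp: \<epsilon>_def)
    then have "h < \<delta>" using nm(2) by (simp add: h_def field_simps)
    then have hN: "(m + 1) ^ N * h \<le> 1 / m - 1 / (m + 1)"
      by (simp add: \<delta>_def pos_less_divide_eq mult.commute)
    have "(engel_map ^^ n) y = 1 / m - h"
      using nm(4)[of y] y by (auto simp: \<epsilon>_def h_def algebra_simps)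
    then have it: "(engel_map ^^ (n + k)) y = (engel_map ^^ k) (1 / m - h)" for k
      by (metis add.commute comp_apply funpow_add)
    \<comment> \<open>Digit number i is read off iterate i - 1, hence the \<open>Suc\<close>:
      iterates n, ..., n + N - 1 give digits n + 1, ..., n + N.\<close>
    let ?A = "(\<lambda>k. Suc (n + k)) ` {..<N}"
    have "?A \<subseteq> engel_indices y"
      using engel_iterate_left_of_reciprocal(2)[OF nm(1) h hN]
      by (auto simp: engel_indices_def it)
    then have "(\<Sum>i\<in>?A. real_of_int (engel_digit y i) powr (- s)) \<le> M"
      using yb by (auto simp: engel_bounded_def)
    moreover have "real_of_int (engel_digit y i) powr (- s) = w" if "i \<in> ?A" for i
      using that engel_iterate_left_of_reciprocal(3)[OF nm(1) h hN]
      by (auto simp: engel_digit_def it w_def add.commute[of _ 1])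
    moreover have "card ?A = N" by (simp add: card_image inj_on_def)
    ultimately show False using N by simp
  qed
  then show "\<exists>W. openin (top_of_set {0<..<1}) W \<and> W \<noteq> {} \<and> W \<subseteq> U \<and> W \<inter> engel_bounded s M = {}"
    using WU U \<epsilon> by (intro exI[of _ "{r - \<epsilon><..<r}"]) (auto simp: openin_open_eq)
qed

section \<open>From the exponent of convergence to bounded sums\<close>

text \<open>The infimum need not be attained, so summability at \<alpha> itself may fail; the slack
  of 1 yields a summable exponent t < \<alpha> + 1.\<close>

lemma engel_exponent_le_imp_bounded:
  assumes x: "x \<in> {0<..<1}" and le: "engel_exponent x \<le> ereal \<alpha>"
  shows "\<exists>M. x \<in> engel_bounded (\<alpha> + 1) M"
proof -
  have "engel_exponent x < ereal (\<alpha> + 1)"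
    by (rule le_less_trans[OF le]) simp
  then obtain t where t: "t < \<alpha> + 1"
    "(\<lambda>n. real_of_int (engel_digit x n) powr (- t)) summable_on engel_indices x"
    unfolding engel_exponent_def Inf_less_iff by auto
  let ?S = "\<Sum>\<^sub>\<infinity>n\<in>engel_indices x. real_of_int (engel_digit x n) powr (- t)"
  obtain M :: nat where M: "?S \<le> M" using real_arch_simple by blast
  have "(\<Sum>n\<in>A. real_of_int (engel_digit x n) powr (- (\<alpha> + 1))) \<le> M"
    if A: "finite A" "A \<subseteq> engel_indices x" for A
  proof -
    have "(\<Sum>n\<in>A. real_of_int (engel_digit x n) powr (- (\<alpha> + 1)))
        \<le> (\<Sum>n\<in>A. real_of_int (engel_digit x n) powr (- t))"
    proof (rule sum_mono)
      fix n assume "n \<in> A"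
      then have "1 \<le> real_of_int (engel_digit x n)"
        using engel_digit_ge_1[of x n] x A by auto
      then show "real_of_int (engel_digit x n) powr (- (\<alpha> + 1)) \<le> real_of_int (engel_digit x n) powr (- t)"
        using t(1) by (intro powr_mono) auto
    qed
    also have "\<dots> \<le> ?S"
      by (rule finite_sum_le_infsum[OF t(2) A]) simp
    finally show ?thesis using M by simp
  qed
  then show ?thesis using x by (auto simp: engel_bounded_def)
qed

lemma first_category_engel_exponent_le:
  "first_category_in (top_of_set {0<..<1}) {x \<in> {0<..<1}. engel_exponent x \<le> ereal \<alpha>}"
proof (rule first_category_in_nowhere_dense_cover[of _ "engel_bounded (\<alpha> + 1)"])
  show "nowhere_dense_in (top_of_set {0<..<1}) (engel_bounded (\<alpha> + 1) M)" for M
    by (rule nowhere_dense_engel_bounded)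
qed (use engel_exponent_le_imp_bounded in blast)

theorem theorem3p5:
  shows "(\<forall>\<alpha>::real. 0 \<le> \<alpha> \<longrightarrow>
            first_category_in (top_of_set {0<..<1}) {x \<in> {0<..<1}. engel_exponent x \<le> ereal \<alpha>})
       \<and> residual_in (top_of_set {0<..<1}) {x \<in> {0<..<1}. engel_exponent x = \<infinity>}"
proof -
  \<comment> \<open>Natural bounds suffice by the Archimedean property, so the complement becomes a
    countable union.\<close>
  have "engel_exponent x \<noteq> \<infinity> \<longleftrightarrow> (\<exists>k::nat. engel_exponent x \<le> ereal k)" for x
    using real_arch_simple by (cases "engel_exponent x") auto
  then have "topspace (top_of_set {0<..<1}) - {x \<in> {0<..<1}. engel_exponent x = \<infinity>}
      = (\<Union>k::nat. {x \<in> {0<..<1}. engel_exponent x \<le> ereal k})"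
    unfolding topspace_euclidean_subtopology by blast
  then show ?thesis
    unfolding residual_in_def
    using first_category_engel_exponent_le first_category_in_UN[OF first_category_engel_exponent_le]
    by auto
qed

end
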